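(* Write $[a,b,c,d]$ for the point $(a+b\sqrt3,\;c+d\sqrt3)\in\mathbf{R}^2$, where $a,b,c,d$ are integers, and for a point $\mathbf{p}\in\mathbf{R}^2$ let $\langle \mathbf{p}\rangle$ be its hexagonal orbit, i.e. the set of images of $\mathbf{p}$ under the rotations about the origin by the angles $k\pi/3$, $k=0,1,\dots,5$ (so the orbit of the origin is the single point $\{(0,0)\}$). Let $$U_{42}=\langle\mathbf{a}_2\rangle\cup\langle\mathbf{b}_1\rangle\cup\langle\mathbf{c}_1\rangle\cup\langle\mathbf{d}_1\rangle\cup\langle\mathbf{e}_1\rangle\cup\langle\mathbf{f}_1\rangle\cup\langle\mathbf{g}_1\rangle,$$ where $\mathbf{a}_2=[0,6,6,0]$, $\mathbf{b}_1=[-2,8,4,-2]$, $\mathbf{c}_1=[-4,9,5,-2]$, $\mathbf{d}_1=[-6,10,6,-2]$, $\mathbf{e}_1=[-10,12,8,-2]$, $\mathbf{f}_1=[-3,7,9,-1]$, $\mathbf{g}_1=[-6,8,12,-2]$, and let $$V_{60}=\langle\mathbf{h}_1\rangle\cup\langle\mathbf{i}_1\rangle\cup\langle\mathbf{j}_1\rangle\cup\langle\mathbf{k}_1\rangle\cup\langle\mathbf{l}_1\rangle\cup\langle\mathbf{m}_1\rangle\cup\langle\mathbf{n}_1\rangle\cup\langle\mathbf{p}_1\rangle\cup\langle\mathbf{q}_1\rangle\cup\langle\mathbf{r}_1\rangle,$$ where $\mathbf{h}_1=[-14,15,7,-4]$, $\mathbf{i}_1=[-16,16,8,-4]$, $\mathbf{j}_1=[8,2,2,0]$,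 $\mathbf{k}_1=[6,3,3,0]$, $\mathbf{l}_1=[-20,18,10,-4]$, $\mathbf{m}_1=[-8,11,7,-2]$, $\mathbf{n}_1=[4,4,4,0]$, $\mathbf{p}_1=[2,5,5,0]$, $\mathbf{q}_1=[-12,13,9,-2]$, $\mathbf{r}_1=[-9,9,15,-3]$. Let $S$ be the set of the following $50$ points: $[0,0,0,0]$, $[-12,16,0,0]$, $[-12,16,24,-4]$, $[-12,18,6,0]$, $[-12,18,18,-4]$, $[-12,20,0,0]$, $[-9,14,24,-5]$, $[-9,16,6,-1]$, $[-8,10,-2,4]$, $[-8,10,10,-4]$, $[-8,12,4,0]$, $[-6,6,6,-2]$, $[-6,7,3,0]$, $[-6,8,0,2]$, $[-6,8,12,-6]$, $[-6,8,12,-2]$, $[-6,9,9,0]$, $[-6,10,6,-2]$, $[-6,10,18,-2]$, $[-6,12,0,2]$, $[-6,12,12,-2]$, $[-6,14,6,-2]$, $[-6,14,18,-2]$, $[-6,16,12,-2]$, $[-5,7,1,1]$, $[-5,9,7,-3]$, $[-5,15,13,-3]$, $[-4,4,-4,4]$, $[-4,6,2,0]$, $[-4,9,17,-2]$, $[-4,12,8,0]$, $[-3,6,12,-3]$, $[-3,7,9,-1]$, $[-3,8,6,-3]$, $[-3,8,6,1]$, $[-2,4,4,-2]$, $[-2,4,4,2]$, $[-2,8,4,-2]$, $[-2,8,16,-2]$, $[0,1,-3,2]$, $[0,2,-6,4]$, $[0,4,0,0]$, $[0,4,12,-4]$, $[0,5,9,-2]$, $[0,6,6,0]$, $[0,8,24,-4]$,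 $[2,8,8,-2]$, $[2,8,20,-2]$, $[4,0,4,0]$, $[6,-2,6,-2]$. Let $G_{295}$ be the graph with vertex set $\bigcup_{\mathbf{s}\in S}\langle \mathbf{s}\rangle$ in which two vertices $\mathbf{u},\mathbf{v}$ are adjacent if and only if $\mathbf{u}-\mathbf{v}\in U_{42}\cup V_{60}$. Then $G_{295}$ has $295$ vertices and $1644$ edges, and its chromatic number is $5$. Hence $\chi(\mathbf{R}^2,C)\ge 5$ when $C$ is a regular dodecagon centered at the origin.
   Context: For a closed convex curve $C\subset\mathbf{R}^2$ symmetric with respect to the origin, $(\mathbf{R}^2,C)$ denotes the Minkowski plane with unit circle $C$: two points $\mathbf{x},\mathbf{y}\in\mathbf{R}^2$ are at Minkowski distance $1$ if $\mathbf{x}-\mathbf{y}\in C$. The chromatic number $\chi(\mathbf{R}^2,C)$ is the least number of colors needed to color all points of $\mathbf{R}^2$ so that no two points at Minkowski distance $1$ receive the same color. A regular dodecagon here means the boundary curve of the polygon. The dodecagon used for the coordinates is the one centered at the origin with vertices $(12,0)$, $(6\sqrt3,6)$, $(6,6\sqrt3)$, $(0,12)$, etc. (that is, $(12\cos(k\pi/6),12\sin(k\pi/6))$, $k=0,\dots,11$); all vectors of $U_{42}\cup V_{60}$ lie on it. *)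

theory Defs
  imports "HOL-Analysis.Analysis"
begin

text \<open>Graphs are given by a vertex set \<open>V\<close> and a set \<open>E\<close> of edges, an edge with endpoints
  \<open>u\<close>, \<open>v\<close> being the set \<open>{u, v}\<close>.\<close>

definition colorable :: "'a set \<Rightarrow> 'a set set \<Rightarrow> nat \<Rightarrow> bool" where
  "colorable V E n \<longleftrightarrow>
     (\<exists>f :: 'a \<Rightarrow> nat. f ` V \<subseteq> {..<n} \<and> (\<forall>u\<in>V. \<forall>v\<in>V. {u, v} \<in> E \<longrightarrow> f u \<noteq> f v))"

text \<open>Valued in \<open>enat\<close>, so that a graph without a finite coloring has chromatic number \<open>\<infinity>\<close>.\<close>

definition chromatic_number :: "'a set \<Rightarrow> 'a set set \<Rightarrow> enat" where
  "chromatic_number V E = Inf (enat ` {n. colorable V E n})"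

text \<open>In the uses below \<open>D\<close> is invariant under negation and does not contain the origin, so that
  \<open>{u, v}\<close> is an edge iff \<open>u - v \<in> D\<close>, and there are no loops.\<close>

definition difference_edges :: "(real \<times> real) set \<Rightarrow> (real \<times> real) set \<Rightarrow> (real \<times> real) set set" where
  "difference_edges V D = {{u, v} | u v. u \<in> V \<and> v \<in> V \<and> u - v \<in> D}"

definition minkowski_chromatic_number :: "(real \<times> real) set \<Rightarrow> enat" where
  "minkowski_chromatic_number C = chromatic_number UNIV (difference_edges UNIV C)"

definition rot :: "real \<Rightarrow> real \<times> real \<Rightarrow> real \<times> real" where
  "rot t p = (cos t * fst p - sin t * snd p, sin t * fst p + cos t * snd p)"

text \<open>Any size and any orientation; \<open>(r * cos t, r * sin t)\<close> is one of the vertices.\<close>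

definition centered_regular_dodecagon :: "(real \<times> real) set \<Rightarrow> bool" where
  "centered_regular_dodecagon C \<longleftrightarrow>
     (\<exists>r t. r > 0 \<and>
        C = frontier (convex hull
              {(r * cos (t + real k * pi / 6), r * sin (t + real k * pi / 6)) | k. k < 12}))"

definition pt :: "int \<Rightarrow> int \<Rightarrow> int \<Rightarrow> int \<Rightarrow> real \<times> real" where
  "pt a b c d = (of_int a + of_int b * sqrt 3, of_int c + of_int d * sqrt 3)"

definition hex_orbit :: "real \<times> real \<Rightarrow> (real \<times> real) set" where
  "hex_orbit p = {rot (real k * pi / 3) p | k. k \<le> 5}"

definition U42 :: "(real \<times> real) set" where
  "U42 = \<Union> (hex_orbit `
     {pt 0 6 6 0, pt (-2) 8 4 (-2), pt (-4) 9 5 (-2), pt (-6) 10 6 (-2), pt (-10) 12 8 (-2),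
      pt (-3) 7 9 (-1), pt (-6) 8 12 (-2)})"

definition V60 :: "(real \<times> real) set" where
  "V60 = \<Union> (hex_orbit `
     {pt (-14) 15 7 (-4), pt (-16) 16 8 (-4), pt 8 2 2 0, pt 6 3 3 0, pt (-20) 18 10 (-4),
      pt (-8) 11 7 (-2), pt 4 4 4 0, pt 2 5 5 0, pt (-12) 13 9 (-2), pt (-9) 9 15 (-3)})"

definition S50 :: "(real \<times> real) set" where
  "S50 =
     {pt 0 0 0 0, pt (-12) 16 0 0, pt (-12) 16 24 (-4), pt (-12) 18 6 0, pt (-12) 18 18 (-4),
      pt (-12) 20 0 0, pt (-9) 14 24 (-5), pt (-9) 16 6 (-1), pt (-8) 10 (-2) 4, pt (-8) 10 10 (-4),
      pt (-8) 12 4 0, pt (-6) 6 6 (-2), pt (-6) 7 3 0, pt (-6) 8 0 2, pt (-6) 8 12 (-6),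
      pt (-6) 8 12 (-2), pt (-6) 9 9 0, pt (-6) 10 6 (-2), pt (-6) 10 18 (-2), pt (-6) 12 0 2,
      pt (-6) 12 12 (-2), pt (-6) 14 6 (-2), pt (-6) 14 18 (-2), pt (-6) 16 12 (-2), pt (-5) 7 1 1,
      pt (-5) 9 7 (-3), pt (-5) 15 13 (-3), pt (-4) 4 (-4) 4, pt (-4) 6 2 0, pt (-4) 9 17 (-2),
      pt (-4) 12 8 0, pt (-3) 6 12 (-3), pt (-3) 7 9 (-1), pt (-3) 8 6 (-3), pt (-3) 8 6 1,
      pt (-2) 4 4 (-2), pt (-2) 4 4 2, pt (-2) 8 4 (-2), pt (-2) 8 16 (-2), pt 0 1 (-3) 2,
      pt 0 2 (-6) 4, pt 0 4 0 0, pt 0 4 12 (-4), pt 0 5 9 (-2), pt 0 6 6 0,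
      pt 0 8 24 (-4), pt 2 8 8 (-2), pt 2 8 20 (-2), pt 4 0 4 0, pt 6 (-2) 6 (-2)}"

definition G295_verts :: "(real \<times> real) set" where
  "G295_verts = (\<Union>s\<in>S50. hex_orbit s)"

definition G295_edges :: "(real \<times> real) set set" where
  "G295_edges = difference_edges G295_verts (U42 \<union> V60)"

end

theory Submission
  imports Defs
begin

text \<open>All points involved lie in \<open>\<int>[\<surd>3]\<^sup>2\<close>, so the claims about the finite graph reduce to
  exact computations with quadruples of integers: rotation by \<open>\<pi>/3\<close> becomes integral on a sublattice
  of index 4, and irrationality of \<open>\<surd>3\<close> makes the quadruples faithful. A direction and its negative
  give the same edges, so edges are counted as pairs of a vertex and one of 51 directions, by
  intersecting the vertex set with its translates. For the lower bound, the colors of a triangle may be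
  fixed by symmetry, after which 4-colorability is a propositional formula that is refuted by
  resolution. Finally, all 102 directions lie on the sides of the dodecagon, and any centered regular
  dodecagon is the image of this one under a scaled rotation, so a coloring of the plane pulls back to
  a coloring of the graph.\<close>

section \<open>Integer coordinates\<close>

type_synonym int4 = "int \<times> int \<times> int \<times> int"

fun real_pt :: "int4 \<Rightarrow> real \<times> real" where
  "real_pt (a, b, c, d) = pt a b c d"

text \<open>Squaring gives \<open>a\<^sup>2 = 3 * b\<^sup>2\<close>, where the exponent of 3 is even
  on the left and odd on the right unless both sides vanish.\<close>

lemma sqrt3_lin_indep:
  assumes "of_int a + of_int b * sqrt 3 = (0 :: real)"
  shows "a = 0 \<and> b = 0"
proof -
  have "(of_int a)\<^sup>2 = (of_int b * sqrt 3)\<^sup>2"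
    using assms by (metis add_eq_0_iff power2_minus)
  then have "real_of_int (a\<^sup>2) = real_of_int (3 * b\<^sup>2)"
    by (simp add: power_mult_distrib)
  then have eq: "a\<^sup>2 = 3 * b\<^sup>2"
    by linarith
  have "b = 0"
  proof (rule ccontr)
    assume b: "b \<noteq> 0"
    have "prime (3 :: int)" by simp
    moreover from b eq have "a \<noteq> 0" by auto
    ultimately have "2 * multiplicity 3 a = 1 + 2 * multiplicity 3 b"
      using b arg_cong[OF eq, of "multiplicity 3"]
      by (simp add: prime_elem_multiplicity_mult_distrib prime_elem_multiplicity_power_distrib)
    then show False by presburger
  qed
  with eq show ?thesis by simp
qed

lemma inj_real_pt: "inj real_pt"
proof (rule injI)
  fix p q assume eq: "real_pt p = real_pt q"
  obtain a b c d where p: "p = (a, b, c, d)" by (cases p)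
  obtain a' b' c' d' where q: "q = (a', b', c', d')" by (cases q)
  have "of_int (a - a') + of_int (b - b') * sqrt 3 = (0 :: real)"
    "of_int (c - c') + of_int (d - d') * sqrt 3 = (0 :: real)"
    using eq by (simp_all add: p q pt_def algebra_simps)
  from this[THEN sqrt3_lin_indep] show "p = q"
    by (simp add: p q)
qed

lemma real_pt_diff: "real_pt (p - q) = real_pt p - real_pt q"
  by (cases p; cases q) (simp add: pt_def algebra_simps)

lemma real_pt_eq_iff: "real_pt p = real_pt q \<longleftrightarrow> p = q"
  using inj_real_pt by (auto dest: injD)

section \<open>Rotation by \<pi>/3 on integer quadruples\<close>

fun rot60 :: "int4 \<Rightarrow> int4" where
  "rot60 (a, b, c, d) = ((a - 3 * d) div 2, (b - c) div 2, (3 * b + c) div 2, (a + d) div 2)"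

text \<open>The parity condition under which the divisions in \<^const>\<open>rot60\<close> are exact.\<close>

fun hex_lattice :: "int4 \<Rightarrow> bool" where
  "hex_lattice (a, b, c, d) \<longleftrightarrow> even (a - d) \<and> even (b - c)"

text \<open>The formula comes from cosine 1/2 and sine \<open>sqrt 3 / 2\<close>. Substituting
  \<open>a = d + 2 * m\<close> and \<open>b = c + 2 * n\<close> removes the halves, and the image
  satisfies the parity condition again, so the rotation can be iterated.\<close>

lemma rot60_hex_lattice:
  assumes "hex_lattice p"
  shows "hex_lattice (rot60 p) \<and> real_pt (rot60 p) = rot (pi / 3) (real_pt p)"
proof -
  obtain a b c d where p: "p = (a, b, c, d)" by (cases p)
  from assms obtain m n where "a - d = 2 * m" "b - c = 2 * n"
    unfolding p hex_lattice.simps by (elim conjE evenE) blast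
  then have mn: "a = d + 2 * m" "b = c + 2 * n"
    by simp_all
  have 1: "(a - 3 * d) div 2 = m - d" "(b - c) div 2 = n"
    "(3 * b + c) div 2 = 3 * n + 2 * c" "(a + d) div 2 = d + m"
    by (simp_all add: mn)
  have "rot60 p = (m - d, n, 3 * n + 2 * c, d + m)"
    using 1 by (simp add: p)
  moreover have "sqrt 3 * (sqrt 3 * x) = 3 * x" for x :: real
    by (simp flip: mult.assoc)
  ultimately show ?thesis
    by (simp add: p mn pt_def rot_def cos_60 sin_60 algebra_simps)
qed

lemma rot_rot: "rot s (rot t p) = rot (s + t) p"
  by (simp add: rot_def cos_add sin_add algebra_simps)

lemma rot_add: "rot t (p + q) = rot t p + rot t q"
  by (simp add: rot_def algebra_simps)

lemma rot_diff: "rot t (p - q) = rot t p - rot t q"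
  by (simp add: rot_def algebra_simps)

lemma rot_scaleR: "rot t (c *\<^sub>R p) = c *\<^sub>R rot t p"
  by (simp add: rot_def algebra_simps)

lemma rot60_funpow:
  assumes "hex_lattice p"
  shows "hex_lattice ((rot60 ^^ k) p) \<and>
    real_pt ((rot60 ^^ k) p) = rot (real k * pi / 3) (real_pt p)"
proof (induction k)
  case 0
  then show ?case using assms by (simp add: rot_def)
next
  case (Suc k)
  have angle: "pi / 3 + real k * pi / 3 = real (Suc k) * pi / 3"
    by (simp add: field_simps)
  from Suc rot60_hex_lattice[of "(rot60 ^^ k) p"] show ?case
    by (simp add: rot_rot angle del: of_nat_Suc)
qed

definition orbit :: "int4 \<Rightarrow> int4 list" where
  "orbit p = map (\<lambda>k. (rot60 ^^ k) p) [0..<6]"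

lemma hex_orbit_real_pt:
  assumes "hex_lattice p"
  shows "hex_orbit (real_pt p) = real_pt ` set (orbit p)"
proof -
  have "hex_orbit (real_pt p) = (\<lambda>k. rot (real k * pi / 3) (real_pt p)) ` {0..<6}"
    by (force simp: hex_orbit_def image_def)
  then show ?thesis
    using rot60_funpow[OF assms] by (simp add: orbit_def image_image)
qed

lemma hex_orbits_real_pt:
  assumes "list_all hex_lattice ps"
  shows "(\<Union>p\<in>real_pt ` set ps. hex_orbit p) = real_pt ` set (concat (map orbit ps))"
  using assms hex_orbit_real_pt by (auto simp: list_all_iff)

definition base_verts :: "int4 list" where
  "base_verts =
  [(0, 0, 0, 0), (- 12, 16, 0, 0), (- 12, 16, 24, - 4), (- 12, 18, 6, 0), (- 12, 18, 18, - 4),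
   (- 12, 20, 0, 0), (- 9, 14, 24, - 5), (- 9, 16, 6, - 1), (- 8, 10, - 2, 4), (- 8, 10, 10, - 4),
   (- 8, 12, 4, 0), (- 6, 6, 6, - 2), (- 6, 7, 3, 0), (- 6, 8, 0, 2), (- 6, 8, 12, - 6),
   (- 6, 8, 12, - 2), (- 6, 9, 9, 0), (- 6, 10, 6, - 2), (- 6, 10, 18, - 2), (- 6, 12, 0, 2),
   (- 6, 12, 12, - 2), (- 6, 14, 6, - 2), (- 6, 14, 18, - 2), (- 6, 16, 12, - 2), (- 5, 7, 1, 1),
   (- 5, 9, 7, - 3), (- 5, 15, 13, - 3), (- 4, 4, - 4, 4), (- 4, 6, 2, 0), (- 4, 9, 17, - 2),
   (- 4, 12, 8, 0), (- 3, 6, 12, - 3), (- 3, 7, 9, - 1), (- 3, 8, 6, - 3), (- 3, 8, 6, 1),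
   (- 2, 4, 4, - 2), (- 2, 4, 4, 2), (- 2, 8, 4, - 2), (- 2, 8, 16, - 2), (0, 1, - 3, 2),
   (0, 2, - 6, 4), (0, 4, 0, 0), (0, 4, 12, - 4), (0, 5, 9, - 2), (0, 6, 6, 0), (0, 8, 24, - 4),
   (2, 8, 8, - 2), (2, 8, 20, - 2), (4, 0, 4, 0), (6, - 2, 6, - 2)]"

definition base_dirs :: "int4 list" where
  "base_dirs =
  [(0, 6, 6, 0), (- 2, 8, 4, - 2), (- 4, 9, 5, - 2), (- 6, 10, 6, - 2), (- 10, 12, 8, - 2),
   (- 3, 7, 9, - 1), (- 6, 8, 12, - 2), (- 14, 15, 7, - 4), (- 16, 16, 8, - 4), (8, 2, 2, 0),
   (6, 3, 3, 0), (- 20, 18, 10, - 4), (- 8, 11, 7, - 2), (4, 4, 4, 0), (2, 5, 5, 0),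
   (- 12, 13, 9, - 2), (- 9, 9, 15, - 3)]"

definition dirs :: "int4 list" where
  "dirs = concat (map orbit base_dirs)"

text \<open>The sorting key need not be injective: that the result is sorted is checked below.\<close>

definition key :: "int4 \<Rightarrow> int" where
  "key = (\<lambda>(a, b, c, d). ((a * 64 + b) * 64 + c) * 64 + d)"

text \<open>The origin occurs six times in its own orbit list. As 295 = 1 + 49 * 6, these are the
  only repetitions.\<close>

definition verts :: "int4 list" where
  "verts = remdups_adj (sort_key key (concat (map orbit base_verts)))"

lemma hex_lattice_base_verts: "list_all hex_lattice base_verts"
  by code_simp

lemma dirs_eq: "U42 \<union> V60 = real_pt ` set dirs"
proof -
  have "list_all hex_lattice base_dirs" by code_simp
  from hex_orbits_real_pt[OF this] show ?thesis
    unfolding dirs_def[symmetric] by (simp add: U42_def V60_def base_dirs_def Un_assoc)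
qed

lemma verts_eq: "G295_verts = real_pt ` set verts"
proof -
  from hex_orbits_real_pt[OF hex_lattice_base_verts] have
    "(\<Union>p\<in>real_pt ` set base_verts. hex_orbit p) = real_pt ` set verts"
    unfolding verts_def by simp
  moreover have "real_pt ` set base_verts = S50"
    by (simp add: base_verts_def S50_def)
  ultimately show ?thesis
    by (simp add: G295_verts_def)
qed

section \<open>Counting differences by merging sorted lists\<close>

fun lex4 :: "int4 \<Rightarrow> int4 \<Rightarrow> bool" where
  "lex4 (a, b, c, d) (a', b', c', d') \<longleftrightarrow>
     (if a = a' then if b = b' then if c = c' then d < d' else c < c' else b < b' else a < a')"

lemma lex4_irrefl: "\<not> lex4 p p"
  by (cases p) simp

lemma lex4_trans: "lex4 p q \<Longrightarrow> lex4 q r \<Longrightarrow> lex4 p r"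
  by (cases p; cases q; cases r) (auto split: if_splits)

lemma lex4_total: "\<not> lex4 p q \<Longrightarrow> \<not> lex4 q p \<Longrightarrow> p = q"
  by (cases p; cases q) (auto split: if_splits)

text \<open>Translation invariance keeps every translate of a sorted vertex list sorted, so it can
  be merged with the original without sorting again.\<close>

lemma lex4_plus: "lex4 (p + d) (q + d) \<longleftrightarrow> lex4 p q"
  by (cases p; cases q; cases d) simp

declare lex4.simps [simp del]

fun common_count :: "int4 list \<Rightarrow> int4 list \<Rightarrow> int" where
  "common_count (x # xs) (y # ys) =
     (if lex4 x y then common_count xs (y # ys)
      else if lex4 y x then common_count (x # xs) ys else 1 + common_count xs ys)"
| "common_count [] ys = 0"
| "common_count xs [] = 0"

text \<open>If the heads differ, the smaller one lies below everything in the other list by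
  transitivity, so it is not a common element and may be dropped.\<close>

lemma common_count_eq_card:
  assumes "sorted_wrt lex4 xs" "sorted_wrt lex4 ys"
  shows "common_count xs ys = int (card (set xs \<inter> set ys))"
  using assms
proof (induction xs ys rule: common_count.induct)
  case (1 x xs y ys)
  consider "lex4 x y" | "\<not> lex4 x y" "lex4 y x" | "\<not> lex4 x y" "\<not> lex4 y x" "x = y"
    using lex4_total by blast
  then show ?case
  proof cases
    case 1
    then have "lex4 x z" if "z \<in> set (y # ys)" for z
      using that "1.prems"(2) 1 by (auto intro: lex4_trans)
    then have "x \<notin> set (y # ys)" using lex4_irrefl by blast
    then have "set (x # xs) \<inter> set (y # ys) = set xs \<inter> set (y # ys)"
      by auto
    then show ?thesis
      using "1.IH"(1) "1.prems" 1 by simp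
  next
    case 2
    then have "lex4 y z" if "z \<in> set (x # xs)" for z
      using that "1.prems"(1) 2 by (auto intro: lex4_trans)
    then have "y \<notin> set (x # xs)" using lex4_irrefl by blast
    then have "set (x # xs) \<inter> set (y # ys) = set (x # xs) \<inter> set ys"
      by auto
    then show ?thesis
      using "1.IH"(2) "1.prems" 2 by simp
  next
    case 3
    then have "x \<notin> set xs" using "1.prems" lex4_irrefl[of x] by auto
    moreover have "set (x # xs) \<inter> set (y # ys) = insert x (set xs \<inter> set ys)"
      using \<open>x = y\<close> by auto
    ultimately show ?thesis
      using "1.IH"(3) "1.prems" 3 by simp
  qed
qed auto

text \<open>Evaluating a conditional makes the simplifier traverse both lists again in every step;
  pattern matching on the outcome of the comparison avoids this.\<close>

definition common_count_step ::
    "bool \<Rightarrow> bool \<Rightarrow> int4 \<Rightarrow> int4 list \<Rightarrow> int4 \<Rightarrow> int4 list \<Rightarrow> int" where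
  "common_count_step l g x xs y ys =
     (if l then common_count xs (y # ys) else if g then common_count (x # xs) ys else 1 + common_count xs ys)"

lemma common_count_code [code]:
  "common_count (x # xs) (y # ys) = common_count_step (lex4 x y) (lex4 y x) x xs y ys"
  "common_count [] ys = 0"
  "common_count xs [] = 0"
  "common_count_step True g x xs y ys = common_count xs (y # ys)"
  "common_count_step False True x xs y ys = common_count (x # xs) ys"
  "common_count_step False False x xs y ys = 1 + common_count xs ys"
  by (simp_all add: common_count_step_def) (cases xs; simp)

definition diff_count :: "int4 list \<Rightarrow> int4 list \<Rightarrow> int" where
  "diff_count vs ds = sum_list (map (\<lambda>d. common_count vs (map (\<lambda>v. v + d) vs)) ds)"

text \<open>A pair \<open>(d, w)\<close> encodes an oriented edge: it ends in \<open>w\<close> and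
  starts in \<open>w - d\<close>, which also belongs to \<open>V\<close>.\<close>

definition diff_pairs :: "int4 set \<Rightarrow> int4 set \<Rightarrow> (int4 \<times> int4) set" where
  "diff_pairs V D = (SIGMA d:D. V \<inter> (\<lambda>v. v + d) ` V)"

lemma diff_count_eq:
  assumes "sorted_wrt lex4 vs" "distinct ds"
  shows "diff_count vs ds = int (card (diff_pairs (set vs) (set ds)))"
proof -
  have "sorted_wrt lex4 (map (\<lambda>v. v + d) vs)" for d
    using assms(1) by (simp add: sorted_wrt_map lex4_plus)
  then have "diff_count vs ds = (\<Sum>d\<in>set ds. int (card (set vs \<inter> (\<lambda>v. v + d) ` set vs)))"
    using assms by (simp add: diff_count_def common_count_eq_card sum_list_distinct_conv_sum_set)
  then show ?thesis
    by (simp add: diff_pairs_def card_SigmaI)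
qed

text \<open>Three turns by \<pi>/3 are negation, so the first three members of each orbit pick one
  direction from each opposite pair, 3 * 17 = 51 in all.\<close>

definition half_dirs :: "int4 list" where
  "half_dirs = concat (map (\<lambda>p. take 3 (orbit p)) base_dirs)"

lemma half_dirs:
  shows "distinct half_dirs"
    and "set dirs = set half_dirs \<union> uminus ` set half_dirs"
    and "set half_dirs \<inter> uminus ` set half_dirs = {}"
proof -
  show "distinct half_dirs" by code_simp
  have "list_all (\<lambda>d. - d \<in> set dirs) half_dirs" by code_simp
  moreover have "list_all (\<lambda>d. d \<in> set dirs) half_dirs" by code_simp
  moreover have "list_all (\<lambda>d. d \<in> set half_dirs \<or> - d \<in> set half_dirs) dirs" by code_simp
  ultimately show "set dirs = set half_dirs \<union> uminus ` set half_dirs"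
    by (fastforce simp: list_all_iff image_iff)
  have "list_all (\<lambda>d. - d \<notin> set half_dirs) half_dirs" by code_simp
  then show "set half_dirs \<inter> uminus ` set half_dirs = {}"
    by (auto simp: list_all_iff)
qed

text \<open>Colors are listed in the order of \<^const>\<open>verts\<close>.\<close>

definition colors :: "nat list" where
  "colors =
  [2, 4, 1, 0, 0, 0, 4, 3, 3, 0, 3, 3, 0, 0, 1, 4, 4, 2, 1, 4, 0, 0, 1, 0, 0, 1, 0, 0, 2, 2, 4, 1,
   2, 1, 3, 2, 1, 1, 3, 2, 2, 1, 2, 3, 2, 4, 3, 4, 3, 0, 1, 2, 1, 1, 4, 4, 0, 0, 0, 2, 1, 3, 0, 1,
   1, 0, 0, 1, 0, 2, 0, 2, 0, 2, 3, 1, 2, 0, 4, 3, 2, 4, 2, 0, 4, 2, 1, 2, 1, 2, 1, 2, 3, 2, 1, 1,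
   2, 0, 1, 2, 3, 3, 0, 4, 1, 2, 0, 0, 1, 0, 1, 2, 2, 3, 1, 4, 2, 0, 0, 0, 2, 0, 3, 2, 3, 4, 0, 3,
   1, 3, 3, 0, 0, 1, 2, 1, 0, 0, 4, 4, 0, 0, 2, 3, 4, 4, 0, 0, 0, 4, 2, 1, 1, 3, 0, 4, 2, 3, 0, 4,
   2, 1, 3, 0, 3, 3, 3, 2, 1, 2, 2, 1, 2, 0, 0, 1, 0, 0, 1, 2, 1, 3, 0, 1, 4, 0, 4, 0, 0, 1, 4, 1,
   2, 3, 3, 1, 1, 0, 3, 2, 2, 3, 2, 1, 2, 3, 3, 3, 4, 4, 0, 2, 4, 0, 4, 1, 0, 4, 2, 2, 3, 1, 0, 1,
   4, 0, 4, 1, 0, 0, 2, 4, 1, 3, 3, 1, 0, 0, 0, 4, 0, 2, 4, 2, 1, 1, 3, 0, 0, 3, 2, 3, 0, 3, 4, 1,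
   3, 2, 3, 1, 1, 4, 0, 3, 1, 2, 1, 2, 0, 4, 4, 0, 0, 4, 0, 2, 2, 4, 3, 2, 2, 0, 0, 1, 1, 3, 0, 0,
   0, 2, 1, 3, 0, 4, 1]"

definition color_class :: "int4 list \<Rightarrow> nat list \<Rightarrow> nat \<Rightarrow> int4 list" where
  "color_class vs cs c = map fst (filter (\<lambda>(v, k). k = c) (zip vs cs))"

text \<open>The last conjunct is properness of the coloring: no direction is a difference of two
  points of one color class. All conditions are gathered in one predicate on lists so that the
  vertex list is evaluated once for all of them.\<close>

definition check_verts :: "int4 list \<Rightarrow> nat list \<Rightarrow> int4 list \<Rightarrow> bool" where
  "check_verts vs cs ds \<longleftrightarrow>
     length vs = 295 \<and> successively lex4 vs \<and> diff_count vs ds = 1644 \<and>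
     list_all (\<lambda>c. successively lex4 (color_class vs cs c) \<and>
       diff_count (color_class vs cs c) ds = 0) [0..<5]"

lemma check_verts: "check_verts verts colors half_dirs"
  by code_simp

lemma colors: "length colors = 295" "list_all (\<lambda>c. c < 5) colors"
  by code_simp+

section \<open>The edges and a 5-coloring\<close>

lemma set_verts: "set verts = set (concat (map orbit base_verts))"
  by (simp add: verts_def)

lemma sorted_iff_successively: "sorted_wrt lex4 vs \<longleftrightarrow> successively lex4 vs"
  by (intro successively_conv_sorted_wrt[symmetric] transpI) (rule lex4_trans)

lemma sorted_verts: "sorted_wrt lex4 verts"
  using check_verts by (simp add: check_verts_def sorted_iff_successively)

lemma sorted_imp_distinct: "sorted_wrt lex4 vs \<Longrightarrow> distinct vs"
  by (induction vs) (use lex4_irrefl in auto)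

lemma card_G295_verts: "card G295_verts = 295"
  using check_verts sorted_imp_distinct[OF sorted_verts]
  by (simp add: verts_eq card_image inj_on_subset[OF inj_real_pt] distinct_card check_verts_def)

text \<open>Every edge can be oriented so that its difference lies in the chosen half of the
  directions.\<close>

lemma G295_edges_eq:
  "G295_edges = (\<lambda>(d, w). {real_pt (w - d), real_pt w}) ` diff_pairs (set verts) (set half_dirs)"
proof (intro equalityI subsetI)
  fix e assume "e \<in> G295_edges"
  then obtain u v where "e = {u, v}" "u \<in> real_pt ` set verts" "v \<in> real_pt ` set verts"
    and "u - v \<in> real_pt ` set dirs"
    unfolding G295_edges_def difference_edges_def verts_eq dirs_eq by blast
  then obtain p q where e: "e = {real_pt p, real_pt q}"
    and p: "p \<in> set verts" and q: "q \<in> set verts"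
    and "real_pt (p - q) \<in> real_pt ` set dirs"
    unfolding real_pt_diff by blast
  then have "p - q \<in> set half_dirs \<union> uminus ` set half_dirs"
    by (simp only: inj_image_mem_iff[OF inj_real_pt] half_dirs(2))
  then have "p - q \<in> set half_dirs \<or> q - p \<in> set half_dirs"
    by (metis Un_iff imageE minus_diff_eq minus_minus)
  then consider "p - q \<in> set half_dirs" | "q - p \<in> set half_dirs"
    by blast
  moreover have mem: "{real_pt a, real_pt b} \<in> (\<lambda>(d, w). {real_pt (w - d), real_pt w}) ` diff_pairs (set verts) (set half_dirs)"
    if "a - b \<in> set half_dirs" "a \<in> set verts" "b \<in> set verts" for a b
    using that by (intro image_eqI[of _ _ "(a - b, a)"])
      (auto simp: diff_pairs_def image_iff insert_commute intro: bexI[of _ b])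
  ultimately show "e \<in> (\<lambda>(d, w). {real_pt (w - d), real_pt w}) ` diff_pairs (set verts) (set half_dirs)"
  proof cases
    case 1
    then show ?thesis using mem[of p q] p q by (simp only: e)
  next
    case 2
    then show ?thesis using mem[of q p] p q by (simp only: e insert_commute[of "real_pt p"])
  qed
next
  fix e assume "e \<in> (\<lambda>(d, w). {real_pt (w - d), real_pt w}) ` diff_pairs (set verts) (set half_dirs)"
  then obtain d w where dw: "(d, w) \<in> diff_pairs (set verts) (set half_dirs)"
    and e: "e = {real_pt w, real_pt (w - d)}"
    by (auto simp: insert_commute)
  from dw have "d \<in> set half_dirs" "w \<in> set verts" "w - d \<in> set verts"
    by (auto simp: diff_pairs_def)
  moreover from this have "real_pt w - real_pt (w - d) \<in> real_pt ` set dirs"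
    by (simp add: half_dirs(2) flip: real_pt_diff)
  ultimately show "e \<in> G295_edges"
    unfolding G295_edges_def difference_edges_def verts_eq dirs_eq e by blast
qed

text \<open>The orientation of an edge is unique: reading it backwards would put both
  \<open>d\<close> and \<open>- d\<close> into \<open>half_dirs\<close>. So the edges are as many as
  the pairs counted by \<open>diff_count\<close>.\<close>

lemma card_G295_edges: "card G295_edges = 1644"
proof -
  have "inj_on (\<lambda>(d, w). {real_pt (w - d), real_pt w}) (diff_pairs (set verts) (set half_dirs))"
  proof (intro inj_onI, clarify)
    fix d w d' w'
    assume d: "(d, w) \<in> diff_pairs (set verts) (set half_dirs)" "(d', w') \<in> diff_pairs (set verts) (set half_dirs)"
      and "{real_pt (w - d), real_pt w} = {real_pt (w' - d'), real_pt w'}"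
    then consider "w = w'" "w - d = w' - d'" | "w - d = w'" "w = w' - d'"
      by (auto simp: doubleton_eq_iff real_pt_eq_iff)
    then show "d = d' \<and> w = w'"
    proof cases
      case 2
      then have "d = - d'" by (simp add: algebra_simps eq_neg_iff_add_eq_0)
      with d half_dirs(3) show ?thesis by (auto simp: diff_pairs_def)
    qed auto
  qed
  then show ?thesis
    using check_verts diff_count_eq[OF sorted_verts half_dirs(1)]
    by (simp add: G295_edges_eq card_image check_verts_def)
qed

lemma diff_pairs_color_class:
  assumes "c < 5"
  shows "diff_pairs (set (color_class verts colors c)) (set half_dirs) = {}"
proof -
  let ?V = "color_class verts colors c"
  have "sorted_wrt lex4 ?V" "diff_count ?V half_dirs = 0"
    using check_verts assms by (auto simp: check_verts_def list_all_iff sorted_iff_successively)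
  then have "card (diff_pairs (set ?V) (set half_dirs)) = 0"
    using diff_count_eq[OF _ half_dirs(1)] by simp
  moreover have "finite (diff_pairs (set ?V) (set half_dirs))"
    by (simp add: diff_pairs_def)
  ultimately show ?thesis
    by simp
qed

lemma colorable_5: "colorable G295_verts G295_edges 5"
proof -
  \<comment> \<open>The color table is indexed by quadruples and is carried over to points by
    inverting \<open>real_pt\<close>.\<close>
  define f where "f p = the (map_of (zip verts colors) (inv real_pt p))" for p
  have len: "length verts = length colors"
    using check_verts colors by (simp add: check_verts_def)
  have f: "(v, f (real_pt v)) \<in> set (zip verts colors)" if "v \<in> set verts" for v
  proof -
    from that obtain c where "map_of (zip verts colors) v = Some c"
      using map_of_zip_is_Some[OF len] by blast
    then show ?thesis
      using inj_real_pt by (auto simp: f_def dest: map_of_SomeD)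
  qed
  have f5: "f (real_pt v) < 5" if "v \<in> set verts" for v
    using set_zip_rightD[OF f[OF that]] colors(2) by (simp add: list_all_iff)
  have "f (real_pt (w - d)) \<noteq> f (real_pt w)" if "(d, w) \<in> diff_pairs (set verts) (set half_dirs)" for d w
  proof
    assume eq: "f (real_pt (w - d)) = f (real_pt w)"
    from that have w: "w \<in> set verts" "w - d \<in> set verts"
      by (auto simp: diff_pairs_def)
    let ?V = "set (color_class verts colors (f (real_pt w)))"
    have "w \<in> ?V" "w - d \<in> ?V"
      using f[OF w(1)] f[OF w(2)] eq by (force simp: color_class_def)+
    then have "(d, w) \<in> diff_pairs ?V (set half_dirs)"
      using that by (auto simp: diff_pairs_def image_iff intro: bexI[of _ "w - d"])
    with diff_pairs_color_class[OF f5[OF w(1)]] show False by simp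
  qed
  then have "f u \<noteq> f v" if "{u, v} \<in> G295_edges" for u v
    using that by (fastforce simp: G295_edges_eq doubleton_eq_iff)
  then show ?thesis
    using f5 unfolding colorable_def by (intro exI[of _ f]) (auto simp: verts_eq)
qed

section \<open>No 4-coloring\<close>

text \<open>The triple \<open>(k, l, r)\<close> stands for the six edges joining the image of the \<open>k\<close>-th base vertex under
  the rotation by \<open>i\<pi>/3\<close> to the image of the \<open>l\<close>-th one under the rotation by \<open>(i + r)\<pi>/3\<close>. The index
  0 belongs to the origin, for which all rotations coincide.\<close>

definition edge_reps :: "(nat \<times> nat \<times> nat) list" where
  "edge_reps =
  [(0, 15, 0), (0, 17, 0), (0, 32, 0), (0, 37, 0), (0, 44, 0), (1, 4, 0), (1, 4, 5), (1, 11, 0),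
   (1, 11, 5), (1, 14, 5), (1, 15, 0), (1, 17, 5), (1, 27, 5), (1, 28, 5), (2, 3, 0), (2, 3, 1),
   (2, 15, 0), (2, 19, 1), (2, 32, 0), (2, 46, 1), (3, 6, 5), (3, 13, 0), (3, 15, 0), (3, 15, 5),
   (3, 16, 5), (3, 18, 0), (3, 31, 0), (4, 5, 0), (4, 5, 1), (4, 15, 0), (4, 17, 0), (4, 43, 0),
   (5, 15, 5), (5, 17, 0), (5, 20, 0), (5, 20, 5), (5, 33, 0), (5, 34, 5), (6, 7, 0), (6, 8, 0),
   (6, 10, 0), (6, 19, 0), (6, 31, 0), (6, 33, 1), (6, 43, 0), (7, 15, 0), (7, 24, 0), (7, 29, 0),
   (7, 31, 0), (7, 31, 5), (7, 32, 5), (7, 34, 5), (7, 42, 0), (8, 9, 5), (8, 14, 5), (8, 18, 5),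
   (8, 29, 5), (8, 38, 5), (8, 44, 1), (9, 10, 1), (9, 17, 5), (9, 18, 0), (9, 25, 5), (9, 39, 3),
   (9, 40, 2), (9, 48, 4), (10, 17, 1), (10, 22, 0), (10, 28, 1), (10, 28, 5), (10, 39, 0),
   (10, 40, 1), (10, 45, 5), (11, 12, 3), (11, 13, 2), (11, 15, 1), (11, 17, 5), (11, 19, 1),
   (11, 20, 0), (11, 28, 3), (11, 33, 5), (11, 41, 3), (11, 41, 4), (11, 42, 4), (11, 46, 0),
   (12, 12, 2), (12, 17, 5), (12, 19, 1), (12, 29, 0), (12, 30, 0), (12, 32, 1), (12, 33, 5),
   (12, 35, 3), (12, 48, 2), (13, 17, 5), (13, 18, 0), (13, 18, 5), (13, 19, 1), (13, 25, 5),
   (13, 29, 5), (13, 31, 1), (13, 38, 5), (13, 41, 2), (13, 44, 1), (13, 49, 2), (13, 49, 3),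
   (14, 27, 2), (14, 27, 3), (14, 37, 5), (14, 38, 0), (14, 40, 3), (15, 15, 1), (15, 16, 1),
   (15, 20, 1), (15, 21, 0), (15, 22, 0), (15, 30, 1), (15, 31, 5), (15, 35, 2), (15, 36, 1),
   (15, 39, 2), (15, 39, 5), (15, 40, 2), (15, 41, 2), (15, 42, 5), (16, 27, 1), (16, 31, 1),
   (16, 31, 5), (16, 32, 1), (16, 34, 1), (16, 39, 0), (16, 39, 1), (16, 48, 1), (16, 49, 1),
   (17, 17, 1), (17, 18, 0), (17, 20, 5), (17, 23, 0), (17, 25, 5), (17, 41, 5), (17, 45, 5),
   (17, 49, 4), (18, 19, 0), (18, 20, 1), (18, 23, 0), (18, 23, 1), (18, 26, 0), (18, 41, 1),
   (18, 44, 1), (19, 20, 5), (19, 22, 0), (19, 27, 0), (19, 27, 5), (19, 33, 1), (19, 37, 1),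
   (19, 40, 0), (19, 41, 1), (19, 47, 5), (20, 21, 1), (20, 41, 0), (20, 41, 1), (20, 48, 0),
   (21, 22, 0), (21, 22, 5), (21, 28, 0), (21, 31, 0), (21, 38, 0), (21, 41, 0), (21, 42, 0),
   (21, 42, 5), (21, 43, 5), (21, 44, 5), (22, 32, 0), (22, 44, 0), (23, 44, 0), (23, 45, 0),
   (23, 45, 5), (24, 29, 0), (24, 29, 5), (24, 31, 1), (24, 33, 5), (24, 35, 4), (24, 38, 5),
   (24, 44, 1), (25, 26, 0), (25, 29, 0), (25, 33, 5), (25, 36, 4), (25, 39, 2), (25, 39, 4),
   (25, 48, 4), (26, 29, 5), (26, 32, 0), (26, 37, 0), (26, 45, 0), (27, 37, 2), (27, 42, 4),
   (27, 44, 5), (28, 28, 2), (28, 30, 0), (28, 31, 1), (28, 35, 3), (28, 36, 1), (28, 37, 5),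
   (28, 38, 0), (28, 38, 5), (28, 42, 4), (28, 44, 1), (28, 48, 2), (28, 48, 3), (29, 44, 1),
   (30, 36, 0), (30, 36, 5), (30, 37, 1), (30, 38, 5), (31, 32, 5), (31, 35, 5), (31, 39, 3),
   (31, 39, 4), (31, 43, 5), (32, 32, 1), (32, 34, 1), (32, 39, 2), (32, 39, 5), (32, 40, 5),
   (32, 43, 5), (33, 37, 5), (33, 38, 0), (33, 39, 4), (33, 45, 5), (34, 39, 0), (34, 39, 1),
   (34, 42, 1), (34, 42, 5), (34, 43, 1), (34, 44, 1), (35, 36, 1), (35, 41, 3), (35, 43, 4),
   (35, 46, 0), (36, 37, 2), (36, 48, 2), (36, 49, 4), (37, 37, 1), (37, 38, 0), (37, 46, 5),
   (37, 47, 5), (37, 48, 4), (37, 49, 4), (38, 44, 1), (38, 48, 0), (39, 43, 2), (39, 43, 3),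
   (39, 44, 1), (40, 42, 2), (40, 42, 3), (40, 43, 4), (40, 44, 1), (41, 41, 2), (41, 42, 1),
   (41, 48, 3), (42, 44, 5), (42, 48, 4), (43, 44, 5), (44, 44, 1), (44, 45, 0), (44, 46, 1),
   (44, 47, 0), (44, 48, 1), (44, 49, 1), (46, 47, 0), (46, 47, 5), (46, 48, 0), (46, 48, 5)]"

fun is_edge :: "int4 list \<Rightarrow> int4 list \<Rightarrow> nat \<times> nat \<times> nat \<Rightarrow> bool" where
  "is_edge ps ds (k, l, r) \<longleftrightarrow> k < 50 \<and> l < 50 \<and> ps ! k - (rot60 ^^ r) (ps ! l) \<in> set ds"

text \<open>Only one edge of each family of six is tested; the other five follow because rotation
  preserves the set of directions.\<close>

lemma edge_reps: "list_all (is_edge base_verts dirs) edge_reps"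
  by code_simp

text \<open>Here \<open>x p c\<close> reads: the vertex \<open>p\<close> has color \<open>c\<close>.
  Each vertex yields the clause that it has a color, each edge one clause per color. With the
  triangle fixed, these clauses are contradictory.\<close>

lemma no_four_coloring_pattern:
  fixes x :: "nat \<times> nat \<Rightarrow> nat \<Rightarrow> bool"
  assumes cover: "\<And>p. x p 0 \<or> x p 1 \<or> x p 2 \<or> x p 3"
    and edge: "\<And>k l r i c. (k, l, r) \<in> set edge_reps \<Longrightarrow> i < 6 \<Longrightarrow>
      \<not> x (k, if k = 0 then 0 else i) c \<or> \<not> x (l, (i + r) mod 6) c"
    and triangle: "x (0, 0) 0" "x (15, 0) 1" "x (15, 1) 2"
  shows False
proof -
  \<comment> \<open>Splitting off 1 leaves an interval between numerals, which the simplifier can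
    enumerate.\<close>
  have upt: "[1..<50] = 1 # [2..<50]"
    by (simp add: upt_conv_Cons)
  have "list_all (\<lambda>p. x p 0 \<or> x p 1 \<or> x p 2 \<or> x p 3)
      ((0, 0) # concat (map (\<lambda>k. map (Pair k) [0, 1, 2, 3, 4, 5]) [1..<50]))"
    using cover by (simp only: list_all_iff) blast
  note cover' = this[unfolded upt, simplified]
  \<comment> \<open>This predicate stays folded while the indices are normalized, which protects the
    shape of the clauses. It is unfolded afterwards, so its own color 1 is already written
    \<open>Suc 0\<close>.\<close>
  define adj where "adj p q \<longleftrightarrow> (\<not> x p 0 \<or> \<not> x q 0) \<and> (\<not> x p (Suc 0) \<or> \<not> x q (Suc 0)) \<and>
    (\<not> x p 2 \<or> \<not> x q 2) \<and> (\<not> x p 3 \<or> \<not> x q 3)" for p q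
  have adj: "list_all (\<lambda>i. adj (k, if k = 0 then 0 else i) (l, (i + r) mod 6)) [0, 1, 2, 3, 4, 5]"
    if "(k, l, r) \<in> set edge_reps" for k l r
    unfolding list_all_iff adj_def by (intro ballI conjI edge[OF that]) auto
  have "list_all (\<lambda>(k, l, r). list_all
      (\<lambda>i. adj (k, if k = 0 then 0 else i) (l, (i + r) mod 6)) [0, 1, 2, 3, 4, 5]) edge_reps"
    unfolding list_all_iff[of _ edge_reps]
  proof
    fix t assume t: "t \<in> set edge_reps"
    obtain k l r where "t = (k, l, r)" by (cases t)
    with adj t show "case t of (k, l, r) \<Rightarrow> list_all
        (\<lambda>i. adj (k, if k = 0 then 0 else i) (l, (i + r) mod 6)) [0, 1, 2, 3, 4, 5]"
      by (simp only: split_conv)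
  qed
  \<comment> \<open>Atoms have to agree syntactically, so all indices are brought into the simplifier's normal
    form \<open>0\<close>, \<open>Suc 0\<close>, \<open>2\<close>, \<open>3\<close>, \<open>\<dots>\<close>\<close>
  note edge' = this[unfolded edge_reps_def, simplified, folded numeral_2_eq_2, unfolded adj_def]
  show False
    using triangle[simplified] cover' edge' by sat
qed

section \<open>From the propositional refutation to the graph\<close>

lemma length_base_verts: "length base_verts = 50"
  by code_simp

lemma base_verts_0: "base_verts ! 0 = 0"
  by (simp add: base_verts_def zero_prod_def)

lemma rot60_funpow_0: "(rot60 ^^ k) 0 = 0"
  by (induction k) (auto simp: zero_prod_def)

lemma cos_plus_of_int: "cos (t + of_int n * (2 * pi)) = cos t"
  and sin_plus_of_int: "sin (t + of_int n * (2 * pi)) = sin t"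
  using cos.plus_of_int[of t n] sin.plus_of_int[of t n] by simp_all

lemma cos_plus_of_nat: "cos (t + real n * (2 * pi)) = cos t"
  and sin_plus_of_nat: "sin (t + real n * (2 * pi)) = sin t"
  using cos_plus_of_int[of t "int n"] sin_plus_of_int[of t "int n"] by simp_all

text \<open>Six steps are a full turn of the plane, and injectivity of \<open>real_pt\<close> brings
  this back to quadruples.\<close>

lemma rot60_funpow_mod_6:
  assumes "hex_lattice p"
  shows "(rot60 ^^ (k mod 6)) p = (rot60 ^^ k) p"
proof -
  have "real k * pi / 3 = real (k mod 6) * pi / 3 + real (k div 6) * (2 * pi)"
    by (subst (1) mult_div_mod_eq[of 6 k, symmetric], subst of_nat_add) (simp add: field_simps)
  then have "rot (real (k mod 6) * pi / 3) = rot (real k * pi / 3)"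
    by (intro ext) (simp only: rot_def cos_plus_of_nat sin_plus_of_nat)
  then have "real_pt ((rot60 ^^ (k mod 6)) p) = real_pt ((rot60 ^^ k) p)"
    using rot60_funpow[OF assms] by simp
  then show ?thesis by (simp only: real_pt_eq_iff)
qed

lemma funpow_base_verts_in_verts:
  assumes "k < 50"
  shows "(rot60 ^^ i) (base_verts ! k) \<in> set verts"
proof -
  have "base_verts ! k \<in> set base_verts"
    using assms by (simp add: length_base_verts)
  moreover from this have "(rot60 ^^ i) (base_verts ! k) = (rot60 ^^ (i mod 6)) (base_verts ! k)"
    using hex_lattice_base_verts by (simp add: rot60_funpow_mod_6 list_all_iff)
  moreover have "i mod 6 < 6"
    by simp
  ultimately show ?thesis
    unfolding set_verts orbit_def by fastforce
qed

text \<open>Integer division is not additive, but on the sublattice \<open>rot60\<close> agrees with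
  the linear map \<open>rot\<close>.\<close>

lemma rot60_diff:
  assumes "hex_lattice p" "hex_lattice q"
  shows "rot60 (p - q) = rot60 p - rot60 q"
proof -
  have "hex_lattice (p - q)"
    using assms by (cases p; cases q) simp
  then have "real_pt (rot60 (p - q)) = real_pt (rot60 p - rot60 q)"
    using assms by (simp add: rot60_hex_lattice real_pt_diff rot_diff)
  then show ?thesis by (simp only: real_pt_eq_iff)
qed

lemma rot60_funpow_diff_dirs:
  assumes "hex_lattice p" "hex_lattice q" "p - q \<in> set dirs"
  shows "(rot60 ^^ k) p - (rot60 ^^ k) q \<in> set dirs"
proof (induction k)
  case (Suc k)
  have "list_all (\<lambda>d. rot60 d \<in> set dirs) dirs"
    by code_simp
  with Suc show ?case
    using rot60_diff rot60_funpow assms(1,2) by (simp add: list_all_iff flip: rot60_diff)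
qed (use assms in simp)

lemma not_colorable_4: "\<not> colorable G295_verts G295_edges 4"
proof
  assume "colorable G295_verts G295_edges 4"
  then obtain f where f4: "f ` G295_verts \<subseteq> {..<4 :: nat}"
    and "\<forall>u\<in>G295_verts. \<forall>v\<in>G295_verts. {u, v} \<in> G295_edges \<longrightarrow> f u \<noteq> f v"
    unfolding colorable_def by blast
  then have f: "f u \<noteq> f v"
    if "u \<in> G295_verts" "v \<in> G295_verts" "{u, v} \<in> G295_edges" for u v
    using that by blast
  define pnt where "pnt p = (rot60 ^^ snd p) (base_verts ! fst p)" for p
  define g where "g p = f (real_pt (pnt p))" for p
  have g: "g (k, if k = 0 then 0 else i) < 4 \<and> g (l, (i + r) mod 6) < 4 \<and>
    g (k, if k = 0 then 0 else i) \<noteq> g (l, (i + r) mod 6)"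
    if klr: "(k, l, r) \<in> set edge_reps" for k l r i
  proof -
    define p where "p = (k, if k = 0 then 0 else i)"
    define q where "q = (l, (i + r) mod 6)"
    have "is_edge base_verts dirs (k, l, r)"
      using edge_reps klr by (auto simp: list_all_iff)
    then have lt: "k < 50" "l < 50" and dir: "base_verts ! k - (rot60 ^^ r) (base_verts ! l) \<in> set dirs"
      by auto
    have lat: "hex_lattice (base_verts ! k)" "hex_lattice (base_verts ! l)"
      using lt hex_lattice_base_verts by (auto simp: list_all_iff length_base_verts)
    \<comment> \<open>For \<open>k = 0\<close> the point is the origin, which every rotation fixes,
      so the index 0 may replace \<open>i\<close>.\<close>
    have "pnt p = (rot60 ^^ i) (base_verts ! k)"
      using rot60_funpow_0 by (simp add: pnt_def p_def base_verts_0)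
    moreover have "pnt q = (rot60 ^^ i) ((rot60 ^^ r) (base_verts ! l))"
      using rot60_funpow_mod_6[OF lat(2), of "i + r"] by (simp add: pnt_def q_def funpow_add)
    ultimately have "pnt p - pnt q \<in> set dirs"
      using rot60_funpow_diff_dirs dir lat rot60_funpow by simp
    then have "real_pt (pnt p) - real_pt (pnt q) \<in> U42 \<union> V60"
      by (auto simp: dirs_eq simp flip: real_pt_diff)
    moreover have "real_pt (pnt p) \<in> G295_verts" "real_pt (pnt q) \<in> G295_verts"
      using funpow_base_verts_in_verts lt by (auto simp: pnt_def p_def q_def verts_eq)
    moreover from calculation have "{real_pt (pnt p), real_pt (pnt q)} \<in> G295_edges"
      unfolding G295_edges_def difference_edges_def by blast
    ultimately show ?thesis
      unfolding p_def[symmetric] q_def[symmetric]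
      using f[of "real_pt (pnt p)" "real_pt (pnt q)"] f4 by (auto simp: g_def)
  qed
  \<comment> \<open>The triangle consists of the origin and two consecutive points of the orbit of
    base vertex 15. The first family joins the origin to both, the second joins them to each
    other.\<close>
  have "(0, 15, 0) \<in> set edge_reps" "(15, 15, 1) \<in> set edge_reps"
    by (simp_all add: edge_reps_def)
  note tri = this[THEN g]
  obtain a b c where abc: "g (0, 0) = a" "g (15, 0) = b" "g (15, 1) = c" by blast
  then have lt: "a < 4" "b < 4" "c < 4" "a \<noteq> b" "a \<noteq> c" "b \<noteq> c"
    using tri(1)[of 0] tri(1)[of 1] tri(2)[of 0] by auto
  have "card ({..<4} - {a, b, c}) = 1"
    using lt by (subst card_Diff_subset) auto
  then obtain d where "{..<4} - {a, b, c} = {d}"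
    by (auto simp: card_1_singleton_iff)
  then have abcd: "{..<4} = {a, b, c, d}"
    using lt by auto
  \<comment> \<open>Renumbering the colors by \<open>[a, b, c, d]\<close> gives the triangle the
    colors 0, 1, 2. Reduction mod 4 makes the covering condition hold for all index pairs, even
    those naming no vertex; on the endpoints of the listed edges it changes nothing.\<close>
  define x where "x p n \<longleftrightarrow> g p mod 4 = [a, b, c, d] ! n" for p n
  show False
  proof (rule no_four_coloring_pattern[of x])
    fix p
    have "g p mod 4 \<in> {a, b, c, d}"
      unfolding abcd[symmetric] by simp
    then show "x p 0 \<or> x p 1 \<or> x p 2 \<or> x p 3"
      by (simp add: x_def)
  next
    fix k l r i n assume "(k, l, r) \<in> set edge_reps"
    from g[OF this, of i] show
      "\<not> x (k, if k = 0 then 0 else i) n \<or> \<not> x (l, (i + r) mod 6) n"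
      by (simp only: x_def mod_less) metis
  qed (use abc lt in \<open>simp_all add: x_def\<close>)
qed

lemma colorable_mono: "colorable V E m \<Longrightarrow> m \<le> n \<Longrightarrow> colorable V E n"
  unfolding colorable_def by (meson lessThan_subset_iff subset_trans)

lemma colorable_imp_ge_5: "colorable G295_verts G295_edges n \<Longrightarrow> 5 \<le> n"
  using not_colorable_4 colorable_mono[of _ _ n 4] by fastforce

section \<open>The dodecagon\<close>

definition dodecagon_vertex :: "real \<Rightarrow> real \<Rightarrow> nat \<Rightarrow> real \<times> real" where
  "dodecagon_vertex r t k = (r * cos (t + real k * pi / 6), r * sin (t + real k * pi / 6))"

text \<open>By periodicity every natural number is a valid index, so neither \<open>Suc j\<close>
  nor a shift by a rotation has to be reduced mod 12.\<close>

lemma dodecagon_vertex_mem: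
  "dodecagon_vertex r t k \<in> {dodecagon_vertex r t k | k. k < 12}"
proof -
  have "t + real k * pi / 6 = t + real (k mod 12) * pi / 6 + real (k div 12) * (2 * pi)"
    by (subst (1) mult_div_mod_eq[of 12 k, symmetric], subst of_nat_add) (simp add: field_simps)
  then have "dodecagon_vertex r t k = dodecagon_vertex r t (k mod 12)"
    by (simp only: dodecagon_vertex_def cos_plus_of_nat sin_plus_of_nat)
  then show ?thesis by (auto intro!: exI[of _ "k mod 12"])
qed

text \<open>The angles between the normal of a side and the vertices are odd multiples of \<pi>/12.
  Folded into the range from 0 to \<pi>, where cosine decreases, such an angle is at least
  \<pi>/12.\<close>

lemma cos_odd_multiple_le:
  assumes "odd (n :: int)"
  shows "cos (of_int n * pi / 12) \<le> cos (pi / 12)"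
proof -
  define m where "m = n mod 24"
  have "odd m" using assms unfolding m_def by presburger
  moreover have "0 \<le> m" "m < 24" by (simp_all add: m_def)
  ultimately have m: "1 \<le> m" "m \<le> 23"
    by presburger+
  have "of_int n * pi / 12 = of_int m * pi / 12 + of_int (n div 24) * (2 * pi)"
    unfolding m_def by (subst (1) mult_div_mod_eq[of 24 n, symmetric], subst of_int_add) (simp add: field_simps)
  then have n: "cos (of_int n * pi / 12) = cos (of_int m * pi / 12)"
    by (simp only: cos_plus_of_int)
  show ?thesis
  proof (cases "m \<le> 12")
    case True
    then have "of_int m * pi / 12 \<le> pi" by (simp add: field_simps)
    moreover have "pi / 12 \<le> of_int m * pi / 12" using m by simp
    ultimately show ?thesis
      unfolding n by (intro cos_monotone_0_pi_le) auto
  next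
    case False
    have "cos (of_int m * pi / 12) = cos (2 * pi - of_int m * pi / 12)"
      by simp
    also have "2 * pi - of_int m * pi / 12 = of_int (24 - m) * pi / 12"
      by (simp add: field_simps)
    also have "cos \<dots> \<le> cos (pi / 12)"
    proof (intro cos_monotone_0_pi_le)
      have "of_int (24 - m) \<le> (12 :: real)" "1 \<le> (of_int (24 - m) :: real)"
        using False m by linarith+
      then show "of_int (24 - m) * pi / 12 \<le> pi" "pi / 12 \<le> of_int (24 - m) * pi / 12"
        by (simp_all add: field_simps)
    qed simp
    finally show ?thesis unfolding n .
  qed
qed

text \<open>The line through a side supports the hull: the outward normal functional attains its
  maximum there, and a nonzero functional has no maximum at an interior point.\<close>

lemma dodecagon_side:
  assumes "r > 0" "0 \<le> s" "s \<le> 1"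
  shows "(1 - s) *\<^sub>R dodecagon_vertex r t j + s *\<^sub>R dodecagon_vertex r t (Suc j)
    \<in> frontier (convex hull {dodecagon_vertex r t k | k. k < 12})"
proof -
  define p where "p = (1 - s) *\<^sub>R dodecagon_vertex r t j + s *\<^sub>R dodecagon_vertex r t (Suc j)"
  define H where "H = convex hull {dodecagon_vertex r t k | k. k < 12}"
  \<comment> \<open>The normal points to the midpoint of the side, halfway between the angles of
    vertices \<open>j\<close> and \<open>j + 1\<close>; its value on the side is the apothem
    \<open>r * cos (pi / 12)\<close>.\<close>
  define \<theta> where "\<theta> = t + (2 * real j + 1) * pi / 12"
  define a where "a = (cos \<theta>, sin \<theta>)"
  have a: "a \<bullet> dodecagon_vertex r t k = r * cos (of_int (2 * (int j - int k) + 1) * pi / 12)" for k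
  proof -
    have "of_int (2 * (int j - int k) + 1) * pi / 12 = \<theta> - (t + real k * pi / 6)"
      by (simp add: \<theta>_def field_simps)
    then show ?thesis
      by (simp only: cos_diff) (simp add: a_def dodecagon_vertex_def algebra_simps)
  qed
  have "a \<noteq> 0"
    using sin_zero_abs_cos_one[of \<theta>] by (auto simp: a_def zero_prod_def)
  have "H \<subseteq> {x. a \<bullet> x \<le> r * cos (pi / 12)}"
    unfolding H_def
  proof (intro hull_minimal convex_halfspace_le subsetI)
    fix x assume "x \<in> {dodecagon_vertex r t k | k. k < 12}"
    then obtain k where x: "x = dodecagon_vertex r t k" by blast
    have "cos (of_int (2 * (int j - int k) + 1) * pi / 12) \<le> cos (pi / 12)"
      by (rule cos_odd_multiple_le) simp
    then show "x \<in> {x. a \<bullet> x \<le> r * cos (pi / 12)}"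
      using \<open>r > 0\<close> unfolding mem_Collect_eq x a by (intro mult_left_mono) simp_all
  qed
  then have "interior H \<subseteq> {x. a \<bullet> x < r * cos (pi / 12)}"
    using interior_mono interior_halfspace_le[OF \<open>a \<noteq> 0\<close>] by blast
  moreover have "a \<bullet> p = r * cos (pi / 12)"
    by (simp add: p_def inner_add_right a algebra_simps)
  moreover have "p \<in> H"
    unfolding p_def H_def using assms
    by (intro convexD_alt convex_convex_hull hull_inc dodecagon_vertex_mem)
  ultimately have "p \<in> closure H" "p \<notin> interior H"
    using closure_subset[of H] by auto
  then show ?thesis
    unfolding p_def[symmetric] H_def[symmetric] frontier_def by blast
qed

text \<open>Describing a point by its side and its position there lets a linear map act by moving
  the two endpoints.\<close>

definition on_dodecagon :: "real \<times> real \<Rightarrow> bool" where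
  "on_dodecagon p \<longleftrightarrow> (\<exists>j s. 0 \<le> s \<and> s \<le> 1 \<and>
     p = (1 - s) *\<^sub>R dodecagon_vertex 12 0 j + s *\<^sub>R dodecagon_vertex 12 0 (Suc j))"

text \<open>A turn by \<open>k * pi / 3\<close> is \<open>2 * k\<close> steps of \<pi>/6 and so
  shifts the vertex index, while the factor \<open>r / 12\<close> adjusts the circumradius.\<close>

lemma scaled_rot_dodecagon_vertex:
  "(r / 12) *\<^sub>R rot t (rot (real k * pi / 3) (dodecagon_vertex 12 0 j)) = dodecagon_vertex r t (2 * k + j)"
proof -
  have "t + real (2 * k + j) * pi / 6 = (t + real k * pi / 3) + real j * pi / 6"
    by (simp add: field_simps)
  then show ?thesis
    by (simp only: rot_rot dodecagon_vertex_def cos_add[of "t + real k * pi / 3"]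
        sin_add[of "t + real k * pi / 3"]) (simp add: rot_def algebra_simps)
qed

lemma scaled_rot_on_dodecagon:
  assumes "on_dodecagon p" "r > 0"
  shows "(r / 12) *\<^sub>R rot t (rot (real k * pi / 3) p)
    \<in> frontier (convex hull {dodecagon_vertex r t k | k. k < 12})"
proof -
  obtain j s where s: "0 \<le> s" "s \<le> 1"
    and p: "p = (1 - s) *\<^sub>R dodecagon_vertex 12 0 j + s *\<^sub>R dodecagon_vertex 12 0 (Suc j)"
    using assms(1) by (auto simp: on_dodecagon_def)
  have "(r / 12) *\<^sub>R rot t (rot (real k * pi / 3) p) =
      (1 - s) *\<^sub>R ((r / 12) *\<^sub>R rot t (rot (real k * pi / 3) (dodecagon_vertex 12 0 j))) +
      s *\<^sub>R ((r / 12) *\<^sub>R rot t (rot (real k * pi / 3) (dodecagon_vertex 12 0 (Suc j))))"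
    by (simp add: p rot_add rot_scaleR scaleR_add_right mult.commute)
  then show ?thesis
    using dodecagon_side[OF assms(2) s] by (simp only: scaled_rot_dodecagon_vertex add_Suc_right)
qed

text \<open>This is the side from (12, 0) to \<open>(6 * sqrt 3, 6)\<close>. Together with the next
  one it represents all sides up to rotation by multiples of \<pi>/3, and all base directions lie on
  these two.\<close>

lemma on_dodecagon_side_0:
  assumes "0 \<le> y" "y \<le> 6" "x = 12 + (sqrt 3 - 2) * y"
  shows "on_dodecagon (x, y)"
  unfolding on_dodecagon_def dodecagon_vertex_def using assms
  by (intro exI[of _ 0] exI[of _ "y / 6"]) (simp add: cos_30 sin_30 field_simps)

lemma on_dodecagon_side_1:
  assumes "6 \<le> y" "y \<le> 6 * sqrt 3" "x + y = 6 + 6 * sqrt 3"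
  shows "on_dodecagon (x, y)"
proof -
  have "sqrt 3 > 1" by simp
  have "2 * pi / 6 = pi / 3" by simp
  moreover define s where "s = (y - 6) / (6 * sqrt 3 - 6)"
  have "s * (6 * sqrt 3 - 6) = y - 6"
    using \<open>sqrt 3 > 1\<close> by (simp add: s_def)
  moreover have "0 \<le> s" "s \<le> 1"
    using assms \<open>sqrt 3 > 1\<close> by (auto simp: s_def divide_simps)
  ultimately show ?thesis
    unfolding on_dodecagon_def dodecagon_vertex_def using assms(3)
    by (intro exI[of _ 1] exI[of _ s]) (simp add: cos_30 sin_30 cos_60 sin_60 algebra_simps)
qed

text \<open>This precision decides all the range conditions on the coordinates of the base
  directions.\<close>

lemma sqrt_3_bounds: "1732 < 1000 * sqrt 3" "1000 * sqrt 3 < 1733"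
proof -
  have "1732 / 1000 < sqrt 3"
    by (rule real_less_rsqrt) (simp add: power2_eq_square)
  then show "1732 < 1000 * sqrt 3" by simp
  have "sqrt 3 < 1733 / 1000"
    by (rule real_less_lsqrt) (simp_all add: power2_eq_square)
  then show "1000 * sqrt 3 < 1733" by simp
qed

lemma on_dodecagon_base_dirs: "list_all (\<lambda>p. on_dodecagon (real_pt p)) base_dirs"
proof -
  have "sqrt 3 * (sqrt 3 * x) = 3 * x" for x :: real
    by (simp flip: mult.assoc)
  note simps = this algebra_simps
  show ?thesis
    unfolding base_dirs_def list.pred_inject(2) real_pt.simps pt_def
  proof (intro conjI list.pred_inject(1))
  \<comment> \<open>For each base direction the first side is tried, then the second.\<close>
  qed ((rule on_dodecagon_side_0; use sqrt_3_bounds in \<open>simp add: simps\<close>; fail) |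
    (rule on_dodecagon_side_1; use sqrt_3_bounds in \<open>simp add: simps\<close>; fail))+
qed

lemma scaled_rot_dirs:
  assumes "d \<in> U42 \<union> V60" "r > 0"
  shows "(r / 12) *\<^sub>R rot t d \<in> frontier (convex hull {dodecagon_vertex r t k | k. k < 12})"
proof -
  have "U42 \<union> V60 = (\<Union>p\<in>real_pt ` set base_dirs. hex_orbit p)"
    by (simp add: U42_def V60_def base_dirs_def Un_assoc)
  with assms obtain p k where "p \<in> set base_dirs" "d = rot (real k * pi / 3) (real_pt p)"
    by (auto simp: hex_orbit_def)
  then show ?thesis
    using scaled_rot_on_dodecagon on_dodecagon_base_dirs assms(2) by (auto simp: list_all_iff)
qed

lemma colorable_G295_if_minkowski:
  assumes "centered_regular_dodecagon C" "colorable UNIV (difference_edges UNIV C) n"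
  shows "colorable G295_verts G295_edges n"
proof -
  obtain r t where "r > 0" and C: "C = frontier (convex hull {dodecagon_vertex r t k | k. k < 12})"
    using assms(1) unfolding centered_regular_dodecagon_def dodecagon_vertex_def by blast
  \<comment> \<open>This similarity takes the dodecagon with vertex (12, 0) to \<open>C\<close>,
    hence directions to points of \<open>C\<close> and edges to pairs at Minkowski distance
    1.\<close>
  define A where "A p = (r / 12) *\<^sub>R rot t p" for p
  have A: "A p - A q = A (p - q)" for p q
    by (simp add: A_def rot_diff scaleR_diff_right)
  have edge: "{A u, A v} \<in> difference_edges UNIV C" if uv: "{u, v} \<in> G295_edges" for u v
  proof -
    obtain u' v' where eq: "{u, v} = {u', v'}" and "u' - v' \<in> U42 \<union> V60"
      using uv unfolding G295_edges_def difference_edges_def by blast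
    then have "A u' - A v' \<in> C"
      using scaled_rot_dirs[OF _ \<open>r > 0\<close>] by (simp add: A) (simp add: A_def C)
    moreover have "{A u, A v} = {A u', A v'}"
      using arg_cong[OF eq, of "image A"] by simp
    ultimately show ?thesis
      unfolding difference_edges_def by blast
  qed
  obtain f where f: "f ` UNIV \<subseteq> {..<n}"
    "\<And>u v. {u, v} \<in> difference_edges UNIV C \<Longrightarrow> f u \<noteq> f v"
    using assms(2) unfolding colorable_def by auto
  show ?thesis
    unfolding colorable_def
  proof (intro exI[of _ "f \<circ> A"] conjI ballI impI)
    show "(f \<circ> A) ` G295_verts \<subseteq> {..<n}"
      using f(1) by auto
    show "(f \<circ> A) u \<noteq> (f \<circ> A) v" if "{u, v} \<in> G295_edges" for u v
      using f(2)[OF edge[OF that]] by simp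
  qed
qed

theorem theorem4p1:
  shows "card G295_verts = 295 \<and> card G295_edges = 1644 \<and>
    chromatic_number G295_verts G295_edges = 5 \<and>
    (\<forall>C. centered_regular_dodecagon C \<longrightarrow> minkowski_chromatic_number C \<ge> 5)"
proof (intro conjI allI impI)
  show "card G295_verts = 295" by (fact card_G295_verts)
  show "card G295_edges = 1644" by (fact card_G295_edges)
  have ge: "5 \<le> enat n" if "colorable G295_verts G295_edges n" for n
    using colorable_imp_ge_5[OF that] by (simp add: numeral_eq_enat)
  show "chromatic_number G295_verts G295_edges = 5"
    unfolding chromatic_number_def
  proof (rule antisym)
    show "Inf (enat ` {n. colorable G295_verts G295_edges n}) \<le> 5"
      using colorable_5 by (intro Inf_lower) (auto simp: numeral_eq_enat)
    show "5 \<le> Inf (enat ` {n. colorable G295_verts G295_edges n})"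
      using ge by (intro Inf_greatest) auto
  qed
  show "minkowski_chromatic_number C \<ge> 5" if "centered_regular_dodecagon C" for C
    unfolding minkowski_chromatic_number_def chromatic_number_def
    using ge colorable_G295_if_minkowski[OF that] by (intro Inf_greatest) auto
qed

end
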